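(* Let $(G_n,R^m_n)$ be a surjective sequence in $\mathbf{S}$ with induced poset $\mathbb{P}$, and for every $n\in\omega$ let $C_n=\{g^\in:g\in G_n\}$. Then: (1) Every $C_n$ is an open cover of $\mathsf{S}\mathbb{P}$. (2) Every open cover of $\mathsf{S}\mathbb{P}$ is refined by some $C_n$. (3) Every $C_n$ consolidates $C_{n+1}$. If moreover $(G_n,R^m_n)$ is a sequence in $\mathbf{B}$, then: (4) Every $C_n$ is a minimal cover and $g\mapsto g^\in$ is a bijection $G_n\to C_n$. (5) For all $m<n$, $g\in G_m$, $h\in G_n$: $(g,h)\in R^m_n$ if and only if $g^\in\supseteq h^\in$. (6) If $(G_n,R^m_n)$ is edge-faithful, then for every $n$ the map $g\mapsto g^\in$ is an isomorphism of graphs $G_n\to C_n$, where $C_n$ carries the overlap relation ($U\sqcap V$ iff $U\cap V\neq\emptyset$). (7) If $(G_n,R^m_n)$ is anti-injective, then $p\mapsto p^\in$ is an isomorphism of posets from $(\mathbb{P},\le)$ onto $(\{p^\in:p\in\mathbb{P}\},\subseteq)$.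
   Context: Graphs and relations. A graph is a finite non-empty set $G$ with a reflexive symmetric relation $\sqcap$ (the edge relation). A relation $R\subseteq H\times G$ between graphs is viewed as a relation from $G$ to $H$; write $R(g)=\{h:(h,g)\in R\}$ and $R^{-1}(h)=\{g:(h,g)\in R\}$; $(c,a)\in Q\circ R$ iff $(c,b)\in Q$ and $(b,a)\in R$ for some $b$. $R$ is: edge-preserving if $(h,g),(h',g')\in R$ and $g\sqcap g'$ imply $h\sqcap h'$; surjective if $R^{-1}(h)\ne\emptyset$ for all $h$; co-surjective if $R(g)\neq\emptyset$ for all $g$; co-injective if for all $h\in H$ there is $g$ with $R(g)=\{h\}$; co-bijective if co-injective and co-surjective; anti-injective if $|R^{-1}(h)|\ge2$ for all $h$. $\mathbf{S}$ (resp. $\mathbf{B}$) is the category of graphs with co-surjective (resp. co-bijective) edge-preserving relations. Sequences. A sequence in $\mathbf{C}$ is a family $(G_n,R^m_n)_{m\le n\in\omega}$ with $R^m_n$ a morphism of $\mathbf{C}$ from $G_n$ to $G_m$, $R^n_n$ the identity and $R^l_m\circ R^m_n=R^l_n$ for $l\le m\le n$. It has a property of morphisms if $R^m_n$ has it for all $m<n$. The induced poset is the disjoint union $\mathbb{P}=\bigsqcup_nG_n$, where for $p\in G_n$, $q\in G_m$, $p\le q$ iff $m\le n$ and $(q,p)\in R^m_n$. The sequence is edge-faithful if for all $n$ and $g,h\in G_n$: $g\sqcap h$ iff $g,h$ have a common lower bound in $\mathbb{P}$. Spectrum. In a poset $\mathbb{P}$, a band is a finite $B\subseteq\mathbb{P}$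 such that every element of $\mathbb{P}$ is comparable to an element of $B$; a cap is a set $C\subseteq\mathbb P$ for which there is a band $B$ such that each $b\in B$ is $\le$ some $c\in C$; a selector is a subset of $\mathbb{P}$ meeting every cap. The spectrum $\mathsf{S}\mathbb{P}$ is the set of minimal selectors (with respect to inclusion) with the topology generated by the sets $p^\in=\{S\in\mathsf{S}\mathbb{P}:p\in S\}$, $p\in\mathbb{P}$. Covers. A cover $C$ is minimal if no $C\setminus\{c\}$, $c\in C$, is a cover. A cover $D$ refines a cover $C$ if each $d\in D$ is contained in some $c\in C$. A cover $C$ consolidates a cover $D$ if $D$ refines $C$ and each $c\in C$ equals $\bigcup\{d\in D:d\subseteq c\}$. *)

theory Defs
  imports "HOL-Analysis.Analysis"
begin

section \<open>Graphs and relations between them\<close>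

record 'a fgraph =
  verts :: "'a set"
  adj :: "'a \<Rightarrow> 'a \<Rightarrow> bool"

text \<open>Only the values of \<^term>\<open>adj G\<close> on \<^term>\<open>verts G\<close> are meaningful.\<close>

definition fin_graph :: "'a fgraph \<Rightarrow> bool" where
  "fin_graph G \<longleftrightarrow> finite (verts G) \<and> verts G \<noteq> {} \<and>
     reflp_on (verts G) (adj G) \<and> symp_on (verts G) (adj G)"

definition graph_iso :: "'a fgraph \<Rightarrow> 'b fgraph \<Rightarrow> ('a \<Rightarrow> 'b) \<Rightarrow> bool" where
  "graph_iso G H f \<longleftrightarrow> fin_graph G \<and> fin_graph H \<and> bij_betw f (verts G) (verts H) \<and>
     (\<forall>x\<in>verts G. \<forall>y\<in>verts G. adj G x y \<longleftrightarrow> adj H (f x) (f y))"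

text \<open>
  A relation from \<open>G\<close> to \<open>H\<close> is a set of pairs \<open>(h, g)\<close> with \<open>h\<close> in \<open>H\<close> and \<open>g\<close> in \<open>G\<close>.
  With this order of components, the preimage of \<open>h\<close> is \<open>R `` {h}\<close>, the image of \<open>g\<close> is
  \<open>R\<inverse> `` {g}\<close>, and the composite of \<open>R\<close> followed by \<open>Q\<close> is \<open>Q O R\<close>.
  In the predicates below, the domain graph \<open>G\<close> comes before the codomain graph \<open>H\<close>.
\<close>

definition edge_preserving :: "'a fgraph \<Rightarrow> 'a fgraph \<Rightarrow> ('a \<times> 'a) set \<Rightarrow> bool" where
  "edge_preserving G H R \<longleftrightarrow>
     (\<forall>h g h' g'. (h, g) \<in> R \<longrightarrow> (h', g') \<in> R \<longrightarrow> adj G g g' \<longrightarrow> adj H h h')"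

definition surjective :: "'a fgraph \<Rightarrow> 'a fgraph \<Rightarrow> ('a \<times> 'a) set \<Rightarrow> bool" where
  "surjective G H R \<longleftrightarrow> (\<forall>h\<in>verts H. R `` {h} \<noteq> {})"

definition co_surjective :: "'a fgraph \<Rightarrow> 'a fgraph \<Rightarrow> ('a \<times> 'a) set \<Rightarrow> bool" where
  "co_surjective G H R \<longleftrightarrow> (\<forall>g\<in>verts G. R\<inverse> `` {g} \<noteq> {})"

definition co_injective :: "'a fgraph \<Rightarrow> 'a fgraph \<Rightarrow> ('a \<times> 'a) set \<Rightarrow> bool" where
  "co_injective G H R \<longleftrightarrow> (\<forall>h\<in>verts H. \<exists>g\<in>verts G. R\<inverse> `` {g} = {h})"

definition co_bijective :: "'a fgraph \<Rightarrow> 'a fgraph \<Rightarrow> ('a \<times> 'a) set \<Rightarrow> bool" where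
  "co_bijective G H R \<longleftrightarrow> co_injective G H R \<and> co_surjective G H R"

definition anti_injective :: "'a fgraph \<Rightarrow> 'a fgraph \<Rightarrow> ('a \<times> 'a) set \<Rightarrow> bool" where
  "anti_injective G H R \<longleftrightarrow> (\<forall>h\<in>verts H. card (R `` {h}) \<ge> 2)"

definition S_morphism :: "'a fgraph \<Rightarrow> 'a fgraph \<Rightarrow> ('a \<times> 'a) set \<Rightarrow> bool" where
  "S_morphism G H R \<longleftrightarrow> fin_graph G \<and> fin_graph H \<and> R \<subseteq> verts H \<times> verts G \<and>
     co_surjective G H R \<and> edge_preserving G H R"

definition B_morphism :: "'a fgraph \<Rightarrow> 'a fgraph \<Rightarrow> ('a \<times> 'a) set \<Rightarrow> bool" where
  "B_morphism G H R \<longleftrightarrow> fin_graph G \<and> fin_graph H \<and> R \<subseteq> verts H \<times> verts G \<and>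
     co_bijective G H R \<and> edge_preserving G H R"


section \<open>Sequences\<close>

text \<open>
  \<open>R m n\<close> is the bonding relation from \<open>G n\<close> to \<open>G m\<close>; it is only meaningful for \<open>m \<le> n\<close>.
  The parameter \<open>mor\<close> is the predicate describing the morphisms of the ambient category.
\<close>

definition graph_seq ::
  "('a fgraph \<Rightarrow> 'a fgraph \<Rightarrow> ('a \<times> 'a) set \<Rightarrow> bool) \<Rightarrow>
   (nat \<Rightarrow> 'a fgraph) \<Rightarrow> (nat \<Rightarrow> nat \<Rightarrow> ('a \<times> 'a) set) \<Rightarrow> bool" where
  "graph_seq mor G R \<longleftrightarrow>
     (\<forall>m n. m \<le> n \<longrightarrow> mor (G n) (G m) (R m n)) \<and>
     (\<forall>n. R n n = Id_on (verts (G n))) \<and>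
     (\<forall>l m n. l \<le> m \<longrightarrow> m \<le> n \<longrightarrow> R l m O R m n = R l n)"

definition seq_has ::
  "('a fgraph \<Rightarrow> 'a fgraph \<Rightarrow> ('a \<times> 'a) set \<Rightarrow> bool) \<Rightarrow>
   (nat \<Rightarrow> 'a fgraph) \<Rightarrow> (nat \<Rightarrow> nat \<Rightarrow> ('a \<times> 'a) set) \<Rightarrow> bool" where
  "seq_has prop G R \<longleftrightarrow> (\<forall>m n. m < n \<longrightarrow> prop (G n) (G m) (R m n))"

text \<open>The induced poset: the vertex \<open>g\<close> of \<open>G n\<close> becomes the pair \<open>(n, g)\<close>.\<close>

definition ind_poset :: "(nat \<Rightarrow> 'a fgraph) \<Rightarrow> (nat \<times> 'a) set" where
  "ind_poset G = (SIGMA n:UNIV. verts (G n))"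

definition ind_le :: "(nat \<Rightarrow> nat \<Rightarrow> ('a \<times> 'a) set) \<Rightarrow> nat \<times> 'a \<Rightarrow> nat \<times> 'a \<Rightarrow> bool" where
  "ind_le R p q \<longleftrightarrow> fst q \<le> fst p \<and> (snd q, snd p) \<in> R (fst q) (fst p)"

definition edge_faithful ::
  "(nat \<Rightarrow> 'a fgraph) \<Rightarrow> (nat \<Rightarrow> nat \<Rightarrow> ('a \<times> 'a) set) \<Rightarrow> bool" where
  "edge_faithful G R \<longleftrightarrow>
     (\<forall>n. \<forall>g\<in>verts (G n). \<forall>h\<in>verts (G n).
        adj (G n) g h \<longleftrightarrow> (\<exists>p\<in>ind_poset G. ind_le R p (n, g) \<and> ind_le R p (n, h)))"

lemma ind_poset_partial_order:
  assumes "graph_seq S_morphism G R"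
  shows "partial_order_on (ind_poset G)
           {(p, q). p \<in> ind_poset G \<and> q \<in> ind_poset G \<and> ind_le R p q}"
proof -
  have id: "R n n = Id_on (verts (G n))" for n
    using assms by (simp add: graph_seq_def)
  have comp: "(a, c) \<in> R l n" if "l \<le> m" "m \<le> n" "(a, b) \<in> R l m" "(b, c) \<in> R m n" for l m n a b c
    using assms that unfolding graph_seq_def by blast
  show ?thesis
    unfolding partial_order_on_def preorder_on_def
  proof (intro conjI)
    show "refl_on (ind_poset G) {(p, q). p \<in> ind_poset G \<and> q \<in> ind_poset G \<and> ind_le R p q}"
      by (auto simp: refl_on_def ind_poset_def ind_le_def id)
    show "trans {(p, q). p \<in> ind_poset G \<and> q \<in> ind_poset G \<and> ind_le R p q}"
      by (auto simp: trans_def ind_le_def intro: comp)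
    show "antisym {(p, q). p \<in> ind_poset G \<and> q \<in> ind_poset G \<and> ind_le R p q}"
      by (auto simp: antisym_def ind_le_def id)
  qed auto
qed


section \<open>The spectrum of a poset\<close>

text \<open>A poset is given by its carrier \<open>P\<close> and its order relation \<open>le\<close>, used only on \<open>P\<close>.\<close>

definition band :: "'p set \<Rightarrow> ('p \<Rightarrow> 'p \<Rightarrow> bool) \<Rightarrow> 'p set \<Rightarrow> bool" where
  "band P le B \<longleftrightarrow> finite B \<and> B \<subseteq> P \<and> (\<forall>p\<in>P. \<exists>b\<in>B. le p b \<or> le b p)"

definition cap :: "'p set \<Rightarrow> ('p \<Rightarrow> 'p \<Rightarrow> bool) \<Rightarrow> 'p set \<Rightarrow> bool" where
  "cap P le C \<longleftrightarrow> C \<subseteq> P \<and> (\<exists>B. band P le B \<and> (\<forall>b\<in>B. \<exists>c\<in>C. le b c))"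

definition selector :: "'p set \<Rightarrow> ('p \<Rightarrow> 'p \<Rightarrow> bool) \<Rightarrow> 'p set \<Rightarrow> bool" where
  "selector P le S \<longleftrightarrow> S \<subseteq> P \<and> (\<forall>C. cap P le C \<longrightarrow> S \<inter> C \<noteq> {})"

definition spectrum :: "'p set \<Rightarrow> ('p \<Rightarrow> 'p \<Rightarrow> bool) \<Rightarrow> 'p set set" where
  "spectrum P le = {S. selector P le S \<and> (\<forall>T. T \<subset> S \<longrightarrow> \<not> selector P le T)}"

definition spec_open :: "'p set \<Rightarrow> ('p \<Rightarrow> 'p \<Rightarrow> bool) \<Rightarrow> 'p \<Rightarrow> 'p set set" where
  "spec_open P le p = {S \<in> spectrum P le. p \<in> S}"

text \<open>
  The library takes the union of the generating sets as the underlying space. The whole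
  spectrum is therefore added to the generators, as the empty intersection of subbasic sets.
\<close>

definition spectrum_topology :: "'p set \<Rightarrow> ('p \<Rightarrow> 'p \<Rightarrow> bool) \<Rightarrow> 'p set topology" where
  "spectrum_topology P le =
     topology_generated_by (insert (spectrum P le) (spec_open P le ` P))"

lemma topspace_spectrum_topology [simp]:
  "topspace (spectrum_topology P le) = spectrum P le"
  by (auto simp: spectrum_topology_def topology_generated_by_topspace spec_open_def)

definition seq_spectrum ::
  "(nat \<Rightarrow> 'a fgraph) \<Rightarrow> (nat \<Rightarrow> nat \<Rightarrow> ('a \<times> 'a) set) \<Rightarrow> (nat \<times> 'a) set topology" where
  "seq_spectrum G R = spectrum_topology (ind_poset G) (ind_le R)"

definition seq_open ::
  "(nat \<Rightarrow> 'a fgraph) \<Rightarrow> (nat \<Rightarrow> nat \<Rightarrow> ('a \<times> 'a) set) \<Rightarrow> nat \<times> 'a \<Rightarrow> (nat \<times> 'a) set set" where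
  "seq_open G R p = spec_open (ind_poset G) (ind_le R) p"

definition level_cover ::
  "(nat \<Rightarrow> 'a fgraph) \<Rightarrow> (nat \<Rightarrow> nat \<Rightarrow> ('a \<times> 'a) set) \<Rightarrow> nat \<Rightarrow> (nat \<times> 'a) set set set" where
  "level_cover G R n = {seq_open G R (n, g) | g. g \<in> verts (G n)}"


section \<open>Covers\<close>

definition is_cover :: "'b topology \<Rightarrow> 'b set set \<Rightarrow> bool" where
  "is_cover X C \<longleftrightarrow> \<Union>C = topspace X"

definition open_cover :: "'b topology \<Rightarrow> 'b set set \<Rightarrow> bool" where
  "open_cover X C \<longleftrightarrow> is_cover X C \<and> (\<forall>U\<in>C. openin X U)"

definition minimal_cover :: "'b topology \<Rightarrow> 'b set set \<Rightarrow> bool" where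
  "minimal_cover X C \<longleftrightarrow> is_cover X C \<and> (\<forall>c\<in>C. \<not> is_cover X (C - {c}))"

definition cover_refines :: "'b set set \<Rightarrow> 'b set set \<Rightarrow> bool" where
  "cover_refines D C \<longleftrightarrow> (\<forall>d\<in>D. \<exists>c\<in>C. d \<subseteq> c)"

definition consolidates :: "'b set set \<Rightarrow> 'b set set \<Rightarrow> bool" where
  "consolidates C D \<longleftrightarrow> cover_refines D C \<and> (\<forall>c\<in>C. c = \<Union>{d \<in> D. d \<subseteq> c})"

definition overlap_graph :: "'b set set \<Rightarrow> 'b set fgraph" where
  "overlap_graph C = \<lparr>verts = C, adj = (\<lambda>U V. U \<inter> V \<noteq> {})\<rparr>"

definition poset_iso ::
  "'p set \<Rightarrow> ('p \<Rightarrow> 'p \<Rightarrow> bool) \<Rightarrow> 'q set \<Rightarrow> ('q \<Rightarrow> 'q \<Rightarrow> bool) \<Rightarrow> ('p \<Rightarrow> 'q) \<Rightarrow> bool" where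
  "poset_iso P le Q le' f \<longleftrightarrow> bij_betw f P Q \<and> (\<forall>p\<in>P. \<forall>q\<in>P. le p q \<longleftrightarrow> le' (f p) (f q))"

end

theory Submission
  imports Defs
begin

text \<open>
  Every cap of the induced poset is refined by a level \<open>G\<^sub>n\<close>, and a set is a selector as soon as
  its complement is not a cap. Since every cap contains a finite cap, Zorn's lemma puts a minimal
  selector inside every selector. If \<open>p\<close> lies in a minimal selector \<open>S\<close>, some cap meets \<open>S\<close> in
  \<open>p\<close> only. Modifying such caps shows that \<open>S\<close> is a filter that contains elements below \<open>p\<close> on
  every later level, which gives (1) and (3). For (2), the \<open>p\<close> for which \<open>p\<^sup>\<in>\<close> lies in no member
  of an open cover form an up-set; if it met every level, it would be a selector and so would
  contain a minimal one, whose filter property contradicts the covering. In \<open>\<^bold>B\<close>, co-injectivity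
  says that \<open>G\<^sub>n - {g}\<close> is not a cap, so that some minimal selector meets \<open>G\<^sub>n\<close> in \<open>g\<close> only;
  (4)--(7) follow.
\<close>

section \<open>Minimal selectors\<close>

lemma cap_mono: "cap P le C \<Longrightarrow> C \<subseteq> D \<Longrightarrow> D \<subseteq> P \<Longrightarrow> cap P le D"
  unfolding cap_def by (meson subsetD)

text \<open>It suffices to keep one element of \<open>C\<close> above each member of the finite
  band. This finiteness is what makes Zorn's lemma applicable to selectors.\<close>

lemma cap_finite_subset:
  assumes "cap P le C"
  obtains F where "finite F" "F \<subseteq> C" "cap P le F"
proof -
  obtain B where B: "band P le B" "\<forall>b\<in>B. \<exists>c\<in>C. le b c" and CP: "C \<subseteq> P"
    using assms by (auto simp: cap_def)
  obtain f where f: "\<forall>b\<in>B. f b \<in> C \<and> le b (f b)"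
    using B(2) by metis
  show thesis
  proof
    show "finite (f ` B)"
      using B(1) by (simp add: band_def)
    show "f ` B \<subseteq> C"
      using f by blast
    then show "cap P le (f ` B)"
      unfolding cap_def using B(1) f CP by blast
  qed
qed

text \<open>A cap disjoint from \<open>S\<close> lies in \<open>P - S\<close>, and enlarging a cap
  inside \<open>P\<close> gives a cap again.\<close>

lemma selector_if_not_cap_compl:
  assumes "S \<subseteq> P" "\<not> cap P le (P - S)"
  shows "selector P le S"
  unfolding selector_def
proof (intro conjI allI impI assms(1))
  fix C assume C: "cap P le C"
  show "S \<inter> C \<noteq> {}"
  proof
    assume "S \<inter> C = {}"
    then have "C \<subseteq> P - S"
      using C by (auto simp: cap_def)
    then show False
      using cap_mono[OF C] assms(2) by blast
  qed
qed

lemma selector_contains_minimal: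
  assumes "selector P le S"
  obtains T where "T \<in> spectrum P le" "T \<subseteq> S"
proof -
  \<comment> \<open>Passing to complements turns minimal selectors into maximal sets. The condition
    \<open>P - S \<subseteq> U\<close> keeps the resulting selector inside \<open>S\<close>.\<close>
  define \<A> where "\<A> = {U. U \<subseteq> P \<and> P - S \<subseteq> U \<and> selector P le (P - U)}"
  have SP: "S \<subseteq> P"
    using assms by (simp add: selector_def)
  have "P - S \<in> \<A>"
    using assms SP by (simp add: \<A>_def double_diff)
  moreover have "\<Union>\<C> \<in> \<A>" if ne: "\<C> \<noteq> {}" and ch: "subset.chain \<A> \<C>" for \<C>
  proof -
    have sub: "\<C> \<subseteq> \<A>"
      using ch by (simp add: subset.chain_def)
    have "(P - \<Union>\<C>) \<inter> C \<noteq> {}" if C: "cap P le C" for C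
    proof
      assume empty: "(P - \<Union>\<C>) \<inter> C = {}"
      obtain F where F: "finite F" "F \<subseteq> C" "cap P le F"
        using cap_finite_subset[OF C] .
      have "F \<subseteq> \<Union>\<C>"
        using F(2) C empty by (auto simp: cap_def)
      \<comment> \<open>A finite subset of the union of a chain lies in one member, whose complement
        would then be a selector missing the cap \<open>F\<close>.\<close>
      then obtain U where U: "U \<in> \<C>" "F \<subseteq> U"
        using finite_subset_Union_chain[OF F(1) _ ne ch] by blast
      then have "selector P le (P - U)"
        using sub by (auto simp: \<A>_def)
      then show False
        using F(3) U(2) by (auto simp: selector_def)
    qed
    then have "selector P le (P - \<Union>\<C>)"
      by (simp add: selector_def)
    then show ?thesis
      using sub ne unfolding \<A>_def by blast
  qed
  ultimately obtain M where M: "M \<in> \<A>" "\<forall>X\<in>\<A>. M \<subseteq> X \<longrightarrow> X = M"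
    using subset_Zorn_nonempty[of \<A>] by blast
  have "\<not> selector P le T" if "T \<subset> P - M" for T
  proof
    assume T: "selector P le T"
    have "P - T \<in> \<A>"
      using T that M(1) by (auto simp: \<A>_def double_diff selector_def)
    then have "P - T = M"
      using M(2) that M(1) by (auto simp: \<A>_def)
    then show False
      using that by blast
  qed
  then have "P - M \<in> spectrum P le"
    using M(1) by (auto simp: \<A>_def spectrum_def)
  moreover have "P - M \<subseteq> S"
    using M(1) by (auto simp: \<A>_def)
  ultimately show thesis
    using that by blast
qed

section \<open>Caps isolating an element of a minimal selector\<close>

lemma spectrum_subset: "S \<in> spectrum P le \<Longrightarrow> S \<subseteq> P"
  by (simp add: spectrum_def selector_def)

lemma spectrum_meets_cap: "S \<in> spectrum P le \<Longrightarrow> cap P le C \<Longrightarrow> S \<inter> C \<noteq> {}"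
  by (simp add: spectrum_def selector_def)

text \<open>By minimality \<open>S - {p}\<close> misses some cap, and \<open>S\<close> can meet that
  cap only in \<open>p\<close>.\<close>

lemma spectrum_cap_singleton:
  assumes "S \<in> spectrum P le" "p \<in> S"
  obtains C where "cap P le C" "S \<inter> C = {p}"
proof -
  have "\<not> selector P le (S - {p})"
    using assms by (auto simp: spectrum_def)
  then obtain C where C: "cap P le C" "(S - {p}) \<inter> C = {}"
    using spectrum_subset[OF assms(1)] by (auto simp: selector_def)
  moreover have "S \<inter> C \<noteq> {}"
    using spectrum_meets_cap[OF assms(1) C(1)] .
  ultimately show thesis
    using that by blast
qed

text \<open>In a cap that meets \<open>S\<close> only in \<open>p\<close>, exchanging
  \<open>p\<close> for the larger \<open>q\<close> leaves a cap. \<open>S\<close> must meet it, and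
  \<open>q\<close> is the only place left.\<close>

lemma spectrum_upward_closed:
  assumes "transp_on P le" and S: "S \<in> spectrum P le" and "p \<in> S" "q \<in> P" "le p q"
  shows "q \<in> S"
proof -
  obtain C where C: "cap P le C" "S \<inter> C = {p}"
    using spectrum_cap_singleton[OF S \<open>p \<in> S\<close>] .
  then obtain B where B: "band P le B" "\<forall>b\<in>B. \<exists>c\<in>C. le b c" and CP: "C \<subseteq> P"
    by (auto simp: cap_def)
  have "\<exists>c\<in>insert q (C - {p}). le b c" if b: "b \<in> B" for b
  proof -
    obtain c where c: "c \<in> C" "le b c"
      using B(2) b by blast
    have "b \<in> P"
      using B(1) b by (auto simp: band_def)
    then have "le b q" if "c = p"
      using assms(1,4,5) c CP that by (blast dest: transp_onD)
    then show ?thesis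
      using c by blast
  qed
  then have "cap P le (insert q (C - {p}))"
    unfolding cap_def using B(1) CP \<open>q \<in> P\<close> by blast
  then show ?thesis
    using spectrum_meets_cap[OF S] C(2) by blast
qed

section \<open>Surjective sequences\<close>

locale surjective_seq =
  fixes G :: "nat \<Rightarrow> 'a fgraph" and R :: "nat \<Rightarrow> nat \<Rightarrow> ('a \<times> 'a) set"
  assumes seq: "graph_seq S_morphism G R" and surj: "seq_has surjective G R"
begin

abbreviation "P \<equiv> ind_poset G"
abbreviation "le \<equiv> ind_le R"
abbreviation "level n \<equiv> {n} \<times> verts (G n)"

section \<open>The order between levels\<close>

lemma fin_graph_G: "fin_graph (G n)"
  using seq by (auto simp: graph_seq_def S_morphism_def)

lemma R_id: "R n n = Id_on (verts (G n))"
  using seq by (simp add: graph_seq_def)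

lemma R_comp: "l \<le> m \<Longrightarrow> m \<le> n \<Longrightarrow> R l m O R m n = R l n"
  using seq by (simp add: graph_seq_def)

lemma R_subset: "m \<le> n \<Longrightarrow> R m n \<subseteq> verts (G m) \<times> verts (G n)"
  using seq by (auto simp: graph_seq_def S_morphism_def)

lemma le_levelD: "le p q \<Longrightarrow> fst q \<le> fst p"
  by (simp add: ind_le_def)

lemma le_refl: "p \<in> P \<Longrightarrow> le p p"
  by (auto simp: ind_le_def ind_poset_def R_id)

lemma le_trans: "le p q \<Longrightarrow> le q r \<Longrightarrow> le p r"
  using R_comp[of "fst r" "fst q" "fst p"] by (auto simp: ind_le_def)

lemma transp_on_le: "transp_on P le"
  by (auto intro: transp_onI le_trans)

lemma le_same_level: "le p q \<Longrightarrow> fst p = fst q \<Longrightarrow> p = q"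
  by (auto simp: ind_le_def R_id prod_eq_iff)

lemma level_subset: "level n \<subseteq> P"
  by (auto simp: ind_poset_def)

lemma mem_level: "p \<in> P \<Longrightarrow> p \<in> level (fst p)"
  by (auto simp: ind_poset_def)

lemma exists_above:
  assumes "p \<in> P" "m \<le> fst p"
  obtains q where "q \<in> level m" "le p q"
proof -
  have "co_surjective (G (fst p)) (G m) (R m (fst p))"
    using seq assms(2) by (auto simp: graph_seq_def S_morphism_def)
  then obtain g where g: "(g, snd p) \<in> R m (fst p)"
    using mem_level[OF assms(1)] unfolding co_surjective_def by (cases p) force
  show thesis
  proof
    show "(m, g) \<in> level m"
      using g R_subset[OF assms(2)] by auto
    show "le p (m, g)"
      using g assms(2) by (simp add: ind_le_def)
  qed
qed

lemma exists_below:
  assumes "p \<in> P" "fst p \<le> n"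
  obtains q where "q \<in> level n" "le q p"
proof (cases "fst p = n")
  \<comment> \<open>Equal levels are treated apart, since \<open>seq_has\<close> gives surjectivity
    only for strictly later levels.\<close>
  case True
  then show thesis
    using that[of p] mem_level[OF assms(1)] le_refl[OF assms(1)] by simp
next
  case False
  then have "surjective (G n) (G (fst p)) (R (fst p) n)"
    using surj assms(2) by (simp add: seq_has_def)
  then obtain g where g: "(snd p, g) \<in> R (fst p) n"
    using mem_level[OF assms(1)] unfolding surjective_def by (cases p) force
  show thesis
  proof (rule that[of "(n, g)"])
    show "(n, g) \<in> level n"
      using g R_subset[OF assms(2)] by auto
    show "le (n, g) p"
      using g assms(2) by (simp add: ind_le_def)
  qed
qed

text \<open>This is the composition law of the bonding relations, split at level
  \<open>m\<close>.\<close>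

lemma exists_between:
  assumes "le q p" "fst p \<le> m" "m \<le> fst q"
  obtains r where "r \<in> level m" "le q r" "le r p"
proof -
  obtain g where g: "(snd p, g) \<in> R (fst p) m" "(g, snd q) \<in> R m (fst q)"
    using assms(1) R_comp[OF assms(2,3)] unfolding ind_le_def by blast
  show thesis
  proof
    show "(m, g) \<in> level m"
      using g R_subset[OF assms(2)] by auto
    show "le q (m, g)" "le (m, g) p"
      using g assms by (auto simp: ind_le_def)
  qed
qed

section \<open>Levels as bands and the caps they refine\<close>

lemma band_level: "band P le (level n)"
  unfolding band_def
proof (intro conjI ballI level_subset)
  show "finite (level n)"
    using fin_graph_G[of n] by (simp add: fin_graph_def)
  fix p assume "p \<in> P"
  then show "\<exists>b\<in>level n. le p b \<or> le b p"
  proof (cases "n \<le> fst p")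
    case True
    then show ?thesis
      using exists_above[OF \<open>p \<in> P\<close>] by blast
  next
    case False
    then have "fst p \<le> n"
      by simp
    then show ?thesis
      using exists_below[OF \<open>p \<in> P\<close>] by blast
  qed
qed

text \<open>A band is finite, so some level is at least as late as all of its members. Each element
  of that level lies below a member of the band.\<close>

lemma cap_iff_level_refines:
  "cap P le C \<longleftrightarrow> C \<subseteq> P \<and> (\<exists>n. \<forall>p\<in>level n. \<exists>c\<in>C. le p c)"
proof
  assume "cap P le C"
  then obtain B where B: "band P le B" "\<forall>b\<in>B. \<exists>c\<in>C. le b c" and CP: "C \<subseteq> P"
    by (auto simp: cap_def)
  have "finite (fst ` B)"
    using B(1) by (simp add: band_def)
  then obtain n where n: "\<forall>k\<in>fst ` B. k \<le> n"
    using finite_nat_set_iff_bounded_le by blast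
  have "\<exists>c\<in>C. le p c" if p: "p \<in> level n" for p
  proof -
    obtain b where b: "b \<in> B" "le p b \<or> le b p"
      using B(1) p level_subset by (force simp: band_def)
    \<comment> \<open>No member of \<open>B\<close> lies beyond level \<open>n\<close>, so
      \<open>b\<close> can be below \<open>p\<close> only on level \<open>n\<close> itself, where
      comparable elements are equal.\<close>
    have "le p b"
    proof (cases "le p b")
      case False
      then have "le b p"
        using b(2) by blast
      moreover from this have "fst b = fst p"
        using n b(1) p le_levelD[of b p] by force
      ultimately have "b = p"
        by (rule le_same_level)
      then show ?thesis
        using \<open>le b p\<close> by simp
    qed
    then show ?thesis
      using B(2) b(1) le_trans by blast
  qed
  then show "C \<subseteq> P \<and> (\<exists>n. \<forall>p\<in>level n. \<exists>c\<in>C. le p c)"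
    using CP by blast
next
  assume "C \<subseteq> P \<and> (\<exists>n. \<forall>p\<in>level n. \<exists>c\<in>C. le p c)"
  then show "cap P le C"
    unfolding cap_def using band_level by blast
qed

lemma cap_refined_by_later_levels:
  assumes "cap P le C"
  obtains n where "\<And>k p. n \<le> k \<Longrightarrow> p \<in> level k \<Longrightarrow> \<exists>c\<in>C. le p c"
proof -
  obtain n where n: "\<forall>p\<in>level n. \<exists>c\<in>C. le p c"
    using assms cap_iff_level_refines by blast
  show thesis
  proof (rule that[of n])
    fix k p assume "n \<le> k" "p \<in> level k"
    then obtain q where "q \<in> level n" "le p q"
      using exists_above[of p n] level_subset by force
    then show "\<exists>c\<in>C. le p c"
      using n le_trans by blast
  qed
qed

lemma cap_level: "cap P le (level n)"
  unfolding cap_iff_level_refines using le_refl[OF subsetD[OF level_subset]] level_subset by metis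

text \<open>If the complement were a cap, some level would refine it. An element of \<open>S\<close>
  on that level would then lie below an element outside \<open>S\<close>.\<close>

lemma selector_if_upward_closed:
  assumes "S \<subseteq> P" "\<And>n. S \<inter> level n \<noteq> {}"
    and "\<And>p q. p \<in> S \<Longrightarrow> q \<in> P \<Longrightarrow> le p q \<Longrightarrow> q \<in> S"
  shows "selector P le S"
proof (rule selector_if_not_cap_compl[OF assms(1)])
  show "\<not> cap P le (P - S)"
  proof
    assume "cap P le (P - S)"
    then obtain n where n: "\<forall>p\<in>level n. \<exists>c\<in>P - S. le p c"
      unfolding cap_iff_level_refines by (elim conjE exE)
    obtain p where p: "p \<in> S \<inter> level n"
      using assms(2)[of n] by (meson all_not_in_conv)
    obtain c where "c \<in> P - S" "le p c"
      using bspec[OF n IntD2[OF p]] by (elim bexE)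
    then show False
      using assms(3)[of p c] p by (simp del: mem_Sigma_iff)
  qed
qed

text \<open>In a cap that meets \<open>S\<close> only in \<open>p\<close>, replace \<open>p\<close>
  by all elements below it on level \<open>m\<close>. The result is still a cap, so \<open>S\<close>
  meets the new part.\<close>

lemma spectrum_exists_below:
  assumes S: "S \<in> spectrum P le" and p: "p \<in> S" and m: "fst p \<le> m"
  obtains q where "q \<in> S" "q \<in> level m" "le q p"
proof -
  obtain C where C: "cap P le C" "S \<inter> C = {p}"
    using spectrum_cap_singleton[OF S p] .
  obtain n where n: "\<And>k q. n \<le> k \<Longrightarrow> q \<in> level k \<Longrightarrow> \<exists>c\<in>C. le q c"
    using cap_refined_by_later_levels[OF C(1)] by blast
  define D where "D = (C - {p}) \<union> {r \<in> level m. le r p}"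
  \<comment> \<open>Level \<open>max m n\<close> is late enough to refine \<open>C\<close> and to
    let an element of level \<open>m\<close> be inserted between \<open>q\<close> and
    \<open>p\<close>.\<close>
  have "\<exists>d\<in>D. le q d" if q: "q \<in> level (max m n)" for q
  proof -
    obtain c where c: "c \<in> C" "le q c"
      using n[OF max.cobounded2 q] by blast
    show ?thesis
    proof (cases "c = p")
      case True
      then show ?thesis
        using exists_between[of q p m] c(2) m q by (force simp: D_def)
    next
      case False
      then show ?thesis
        using c by (auto simp: D_def)
    qed
  qed
  moreover have "D \<subseteq> P"
    using C(1) level_subset by (auto simp: D_def cap_def)
  ultimately have "cap P le D"
    using cap_iff_level_refines by blast
  then obtain q where "q \<in> S" "q \<in> D"
    using spectrum_meets_cap[OF S] by blast
  then show thesis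
    using that C(2) by (auto simp: D_def)
qed

text \<open>Take caps isolating \<open>p\<close> and \<open>q\<close> in \<open>S\<close>, and an
  element \<open>r\<close> of \<open>S\<close> on a level that refines both. The cap members above
  \<open>r\<close> belong to \<open>S\<close> by upward closure, so they are \<open>p\<close> and
  \<open>q\<close>.\<close>

lemma spectrum_directed:
  assumes S: "S \<in> spectrum P le" and "p \<in> S" "q \<in> S"
  obtains r where "r \<in> S" "le r p" "le r q"
proof -
  obtain C where C: "cap P le C" "S \<inter> C = {p}"
    using spectrum_cap_singleton[OF S \<open>p \<in> S\<close>] .
  obtain D where D: "cap P le D" "S \<inter> D = {q}"
    using spectrum_cap_singleton[OF S \<open>q \<in> S\<close>] .
  obtain m where m: "\<And>k r. m \<le> k \<Longrightarrow> r \<in> level k \<Longrightarrow> \<exists>c\<in>C. le r c"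
    using cap_refined_by_later_levels[OF C(1)] by blast
  obtain n where n: "\<And>k r. n \<le> k \<Longrightarrow> r \<in> level k \<Longrightarrow> \<exists>d\<in>D. le r d"
    using cap_refined_by_later_levels[OF D(1)] by blast
  obtain r where r: "r \<in> S" "r \<in> level (max m n)"
    using spectrum_meets_cap[OF S cap_level] by blast
  obtain c d where c: "c \<in> C" "le r c" and d: "d \<in> D" "le r d"
    using m[OF max.cobounded1 r(2)] n[OF max.cobounded2 r(2)] by blast
  have "c \<in> P" "d \<in> P"
    using c(1) d(1) C(1) D(1) by (auto simp: cap_def)
  then have "c \<in> S" "d \<in> S"
    using spectrum_upward_closed[OF transp_on_le S r(1)] c(2) d(2) by blast+
  then have "c = p" "d = q"
    using c(1) d(1) C(2) D(2) by blast+
  then show thesis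
    using that r(1) c(2) d(2) by blast
qed

section \<open>Level covers\<close>

lemma topspace_seq_spectrum: "topspace (seq_spectrum G R) = spectrum P le"
  by (simp add: seq_spectrum_def)

lemma mem_seq_open: "S \<in> seq_open G R p \<longleftrightarrow> S \<in> spectrum P le \<and> p \<in> S"
  by (simp add: seq_open_def spec_open_def)

lemma level_cover_eq: "level_cover G R n = seq_open G R ` level n"
  by (auto simp: level_cover_def)

lemma seq_open_mono:
  assumes "le p q" "q \<in> P"
  shows "seq_open G R p \<subseteq> seq_open G R q"
proof
  fix S assume "S \<in> seq_open G R p"
  then show "S \<in> seq_open G R q"
    using spectrum_upward_closed[OF transp_on_le _ _ assms(2,1)] by (simp add: mem_seq_open)
qed

text \<open>Directedness of minimal selectors handles finite intersections, so the generating sets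
  already form a base.\<close>

lemma seq_open_subset_if_openin:
  assumes "openin (seq_spectrum G R) U" "S \<in> U"
  obtains p where "p \<in> S" "seq_open G R p \<subseteq> U"
proof -
  have "generate_topology_on (insert (spectrum P le) (spec_open P le ` P)) U"
    using assms(1) by (simp add: seq_spectrum_def spectrum_topology_def openin_topology_generated_by_iff)
  \<comment> \<open>The claim is restricted to the spectrum so that the intersection case can use
    the filter property of \<open>S\<close>.\<close>
  then have "\<forall>S\<in>U \<inter> spectrum P le. \<exists>p\<in>S. seq_open G R p \<subseteq> U"
  proof induction
    case Empty
    then show ?case by simp
  next
    case (Int U V)
    show ?case
    proof
      fix S assume S: "S \<in> U \<inter> V \<inter> spectrum P le"
      then have "S \<in> U \<inter> spectrum P le" "S \<in> V \<inter> spectrum P le"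
        by simp_all
      then obtain p q where pq: "p \<in> S" "seq_open G R p \<subseteq> U" "q \<in> S" "seq_open G R q \<subseteq> V"
        using Int.IH by meson
      obtain r where r: "r \<in> S" "le r p" "le r q"
        using spectrum_directed[of S p q] pq(1,3) S by (metis IntD2)
      have "p \<in> P" "q \<in> P"
        using spectrum_subset[of S] S pq(1,3) by auto
      then have "seq_open G R r \<subseteq> seq_open G R p" "seq_open G R r \<subseteq> seq_open G R q"
        using seq_open_mono r(2,3) by simp_all
      then show "\<exists>p\<in>S. seq_open G R p \<subseteq> U \<inter> V"
        using r(1) pq by blast
    qed
  next
    case (UN K)
    show ?case
    proof
      fix S assume S: "S \<in> \<Union>K \<inter> spectrum P le"
      then obtain U where U: "U \<in> K" "S \<in> U \<inter> spectrum P le"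
        by blast
      then obtain p where "p \<in> S" "seq_open G R p \<subseteq> U"
        using UN.IH by meson
      then show "\<exists>p\<in>S. seq_open G R p \<subseteq> \<Union>K"
        using U(1) by blast
    qed
  next
    case (Basis U)
    then consider "U = spectrum P le" | p where "U = seq_open G R p"
      by (auto simp: seq_open_def)
    then show ?case
    proof cases
      \<comment> \<open>Every basic set lies in the spectrum, so any element of \<open>S\<close>
        serves; level 0 supplies one.\<close>
      case 1
      then show ?thesis
        using spectrum_meets_cap[OF _ cap_level[of 0]] mem_seq_open by blast
    next
      case 2
      then show ?thesis
        by (auto simp: mem_seq_open)
    qed
  qed
  moreover have "S \<in> spectrum P le"
    using openin_subset[OF assms(1)] assms(2) topspace_seq_spectrum by blast
  ultimately show thesis
    using that assms(2) by blast
qed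

section \<open>Openness, cofinality and consolidation of the level covers\<close>

lemma open_cover_level_cover: "open_cover (seq_spectrum G R) (level_cover G R n)"
  unfolding open_cover_def is_cover_def
proof
  show "\<Union>(level_cover G R n) = topspace (seq_spectrum G R)"
    using spectrum_meets_cap[OF _ cap_level[of n]]
    by (fastforce simp: topspace_seq_spectrum level_cover_eq mem_seq_open)
  show "\<forall>U\<in>level_cover G R n. openin (seq_spectrum G R) U"
    using level_subset[of n]
    by (auto simp: level_cover_eq seq_open_def seq_spectrum_def spectrum_topology_def
        intro!: topology_generated_by_Basis)
qed

lemma open_cover_refined_by_level_cover:
  assumes "open_cover (seq_spectrum G R) C"
  shows "\<exists>n. cover_refines (level_cover G R n) C"
proof (rule ccontr)
  assume neg: "\<nexists>n. cover_refines (level_cover G R n) C"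
  define S where "S = {p \<in> P. \<forall>U\<in>C. \<not> seq_open G R p \<subseteq> U}"
  have "selector P le S"
  proof (rule selector_if_upward_closed)
    show "S \<inter> level n \<noteq> {}" for n
    proof -
      have "\<not> cover_refines (level_cover G R n) C"
        using neg by simp
      then obtain p where "p \<in> level n" "\<forall>U\<in>C. \<not> seq_open G R p \<subseteq> U"
        unfolding cover_refines_def level_cover_eq by blast
      then show ?thesis
        using level_subset[of n] unfolding S_def by blast
    qed
    show "q \<in> S" if "p \<in> S" "q \<in> P" "le p q" for p q
      using that seq_open_mono[of p q] unfolding S_def by blast
  qed (auto simp: S_def)
  then obtain T where T: "T \<in> spectrum P le" "T \<subseteq> S"
    by (rule selector_contains_minimal)
  then obtain U where U: "U \<in> C" "T \<in> U" "openin (seq_spectrum G R) U"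
    using assms unfolding open_cover_def is_cover_def topspace_seq_spectrum by blast
  then obtain p where "p \<in> T" "seq_open G R p \<subseteq> U"
    using seq_open_subset_if_openin by blast
  then show False
    using U(1) T(2) by (auto simp: S_def)
qed

text \<open>Refinement comes from elements above a given one on an earlier level. The union formula
  comes from the elements that each minimal selector has below a given one on later levels.\<close>

lemma consolidates_level_cover:
  assumes "m \<le> n"
  shows "consolidates (level_cover G R m) (level_cover G R n)"
  unfolding consolidates_def cover_refines_def level_cover_eq
proof (intro conjI; clarsimp)
  fix h assume "h \<in> verts (G n)"
  then have "(n, h) \<in> P"
    using level_subset by blast
  then obtain q where "q \<in> level m" "le (n, h) q"
    using exists_above[of "(n, h)" m] assms by (metis fst_conv)
  then show "\<exists>g\<in>verts (G m). seq_open G R (n, h) \<subseteq> seq_open G R (m, g)"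
    using seq_open_mono[of "(n, h)" q] level_subset[of m] by blast
next
  fix g assume g: "g \<in> verts (G m)"
  have "S \<in> \<Union>{d \<in> seq_open G R ` level n. d \<subseteq> seq_open G R (m, g)}"
    if S: "S \<in> seq_open G R (m, g)" for S
  proof -
    obtain q where q: "q \<in> S" "q \<in> level n" "le q (m, g)"
      using spectrum_exists_below[of S "(m, g)" n] S assms by (auto simp: mem_seq_open)
    then have "S \<in> seq_open G R q"
      using S by (simp add: mem_seq_open)
    moreover have "seq_open G R q \<subseteq> seq_open G R (m, g)"
      using seq_open_mono[OF q(3)] g level_subset[of m] by blast
    ultimately show ?thesis
      using q(2) by blast
  qed
  moreover have "\<Union>{d \<in> seq_open G R ` level n. d \<subseteq> seq_open G R (m, g)} \<subseteq> seq_open G R (m, g)"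
    by (rule Union_least) simp
  ultimately show "seq_open G R (m, g) =
      \<Union>{d \<in> seq_open G R ` level n. d \<subseteq> seq_open G R (m, g)}"
    by (rule subset_antisym[OF subsetI])
qed

end

section \<open>Sequences of co-bijective relations\<close>

locale co_bijective_seq = surjective_seq +
  assumes B_seq: "graph_seq B_morphism G R"
begin

text \<open>Co-injectivity puts on every later level a vertex whose only upper bound on the level of
  \<open>p\<close> is \<open>p\<close>. Hence that level without \<open>p\<close> is not a cap, and
  its complement is a selector.\<close>

lemma spectrum_meets_level_once:
  assumes "p \<in> P"
  obtains S where "S \<in> spectrum P le" "S \<inter> level (fst p) = {p}"
proof -
  define n where "n = fst p"
  have p: "p \<in> level n"
    using mem_level[OF assms] by (simp add: n_def)
  have "\<not> cap P le (level n - {p})"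
  proof
    assume "cap P le (level n - {p})"
    then obtain k where k: "\<And>j q. k \<le> j \<Longrightarrow> q \<in> level j \<Longrightarrow> \<exists>c\<in>level n - {p}. le q c"
      using cap_refined_by_later_levels by blast
    have "co_injective (G (max n k)) (G n) (R n (max n k))"
      using B_seq by (simp add: graph_seq_def B_morphism_def co_bijective_def)
    then obtain h where h: "h \<in> verts (G (max n k))" "(R n (max n k))\<inverse> `` {h} = {snd p}"
      using p by (auto simp: co_injective_def)
    obtain c where c: "c \<in> level n - {p}" "le (max n k, h) c"
      using k[of "max n k" "(max n k, h)"] h(1) by auto
    then have "snd c \<in> (R n (max n k))\<inverse> `` {h}"
      by (auto simp: ind_le_def)
    then show False
      using h(2) c(1) p by (auto simp: prod_eq_iff)
  qed
  then have "selector P le (P - (level n - {p}))"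
    using selector_if_not_cap_compl[of "P - (level n - {p})" P le] level_subset[of n]
    by (simp add: double_diff subset_iff)
  then obtain S where S: "S \<in> spectrum P le" "S \<subseteq> P - (level n - {p})"
    by (rule selector_contains_minimal)
  moreover have "S \<inter> level n = {p}"
    using spectrum_meets_cap[OF S(1) cap_level[of n]] S(2) by blast
  ultimately show thesis
    using that by (simp add: n_def)
qed

lemma seq_open_nonempty:
  assumes "p \<in> P"
  shows "seq_open G R p \<noteq> {}"
proof -
  obtain S where S: "S \<in> spectrum P le" "S \<inter> level (fst p) = {p}"
    using spectrum_meets_level_once[OF assms] .
  then have "S \<in> seq_open G R p"
    using mem_seq_open by blast
  then show ?thesis
    by blast
qed

text \<open>Test the inclusion on a minimal selector whose only element on the level of
  \<open>p\<close> is \<open>p\<close>. It contains \<open>q\<close>, hence also an element below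
  \<open>q\<close> on that level, which must be \<open>p\<close>.\<close>

lemma seq_open_subset_iff_le:
  assumes "p \<in> P" "q \<in> P" "fst q \<le> fst p"
  shows "seq_open G R p \<subseteq> seq_open G R q \<longleftrightarrow> le p q"
proof
  assume sub: "seq_open G R p \<subseteq> seq_open G R q"
  obtain S where S: "S \<in> spectrum P le" "S \<inter> level (fst p) = {p}"
    using spectrum_meets_level_once[OF assms(1)] .
  then have "q \<in> S"
    using sub mem_seq_open by blast
  then obtain r where r: "r \<in> S" "r \<in> level (fst p)" "le r q"
    using spectrum_exists_below[OF S(1) _ assms(3)] by blast
  have "r = p"
    using IntI[OF r(1,2)] S(2) by simp
  then show "le p q"
    using r(3) by simp
qed (use seq_open_mono assms in blast)

lemma seq_open_subset_same_level:
  assumes "p \<in> P" "q \<in> P" "fst p = fst q" "seq_open G R p \<subseteq> seq_open G R q"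
  shows "p = q"
  using seq_open_subset_iff_le[of p q] assms le_same_level[of p q] by simp

section \<open>Minimality, overlaps and order of the level covers\<close>

lemma bij_betw_seq_open:
  "bij_betw (\<lambda>g. seq_open G R (n, g)) (verts (G n)) (level_cover G R n)"
proof (rule bij_betw_imageI)
  show "inj_on (\<lambda>g. seq_open G R (n, g)) (verts (G n))"
  proof
    fix g h assume "g \<in> verts (G n)" "h \<in> verts (G n)" "seq_open G R (n, g) = seq_open G R (n, h)"
    then show "g = h"
      using seq_open_subset_same_level[of "(n, g)" "(n, h)"] level_subset[of n] by auto
  qed
qed (auto simp: level_cover_def)

lemma minimal_cover_level_cover: "minimal_cover (seq_spectrum G R) (level_cover G R n)"
  unfolding minimal_cover_def
proof
  show "is_cover (seq_spectrum G R) (level_cover G R n)"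
    using open_cover_level_cover by (simp add: open_cover_def)
  show "\<forall>c\<in>level_cover G R n. \<not> is_cover (seq_spectrum G R) (level_cover G R n - {c})"
  proof
    fix c assume "c \<in> level_cover G R n"
    then obtain p where p: "p \<in> level n" "c = seq_open G R p"
      by (auto simp: level_cover_eq)
    have "p \<in> P" "fst p = n"
      using p(1) level_subset[of n] by auto
    then obtain S where S: "S \<in> spectrum P le" "S \<inter> level n = {p}"
      using spectrum_meets_level_once by metis
    \<comment> \<open>A set \<open>seq_open G R q\<close> with \<open>q\<close> on level
      \<open>n\<close> contains \<open>S\<close> only for \<open>q = p\<close>.\<close>
    have "S \<notin> \<Union>(level_cover G R n - {c})"
      using S(2) p(2) by (auto simp: level_cover_eq mem_seq_open)
    then show "\<not> is_cover (seq_spectrum G R) (level_cover G R n - {c})"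
      using S(1) by (auto simp: is_cover_def topspace_seq_spectrum)
  qed
qed

text \<open>A selector in the overlap is directed, which gives a common lower bound
  \<open>r\<close>. Conversely \<open>seq_open G R r\<close> is non-empty and lies in both
  sets.\<close>

lemma seq_open_overlap_iff:
  assumes "p \<in> P" "q \<in> P"
  shows "seq_open G R p \<inter> seq_open G R q \<noteq> {} \<longleftrightarrow> (\<exists>r\<in>P. le r p \<and> le r q)"
proof
  assume "seq_open G R p \<inter> seq_open G R q \<noteq> {}"
  then obtain S where S: "S \<in> spectrum P le" "p \<in> S" "q \<in> S"
    by (auto simp: mem_seq_open)
  then obtain r where "r \<in> S" "le r p" "le r q"
    by (rule spectrum_directed)
  then show "\<exists>r\<in>P. le r p \<and> le r q"
    using spectrum_subset[OF S(1)] by blast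
next
  assume "\<exists>r\<in>P. le r p \<and> le r q"
  then obtain r where "r \<in> P" "le r p" "le r q"
    by blast
  then show "seq_open G R p \<inter> seq_open G R q \<noteq> {}"
    using seq_open_nonempty[of r] seq_open_mono[of r] assms by blast
qed

lemma graph_iso_overlap_graph:
  assumes "edge_faithful G R"
  shows "graph_iso (G n) (overlap_graph (level_cover G R n)) (\<lambda>g. seq_open G R (n, g))"
  unfolding graph_iso_def
proof (intro conjI ballI)
  show "fin_graph (G n)"
    by (rule fin_graph_G)
  \<comment> \<open>Non-empty members are exactly what reflexivity of the overlap relation
    requires.\<close>
  have "U \<noteq> {}" if "U \<in> level_cover G R n" for U
    using seq_open_nonempty that level_subset unfolding level_cover_eq by blast
  moreover have "finite (level_cover G R n)" "level_cover G R n \<noteq> {}"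
    using fin_graph_G[of n] by (simp_all add: fin_graph_def level_cover_eq)
  ultimately show "fin_graph (overlap_graph (level_cover G R n))"
    by (simp add: fin_graph_def overlap_graph_def reflp_on_def symp_on_def Int_commute)
  show "bij_betw (\<lambda>g. seq_open G R (n, g)) (verts (G n))
      (verts (overlap_graph (level_cover G R n)))"
    using bij_betw_seq_open by (simp add: overlap_graph_def)
  fix g h assume gh: "g \<in> verts (G n)" "h \<in> verts (G n)"
  then have "(n, g) \<in> P" "(n, h) \<in> P"
    using level_subset by auto
  then show "adj (G n) g h \<longleftrightarrow>
      adj (overlap_graph (level_cover G R n)) (seq_open G R (n, g)) (seq_open G R (n, h))"
    using assms gh seq_open_overlap_iff by (simp add: edge_faithful_def overlap_graph_def)
qed

text \<open>The remaining case has \<open>q\<close> on a strictly later level than \<open>p\<close>,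
  where \<open>le p q\<close> fails; anti-injectivity excludes the inclusion as well.\<close>

lemma seq_open_subset_iff_le_anti_injective:
  assumes anti: "seq_has anti_injective G R" and p: "p \<in> P" and q: "q \<in> P"
  shows "seq_open G R p \<subseteq> seq_open G R q \<longleftrightarrow> le p q"
proof (cases "fst q \<le> fst p")
  case True
  then show ?thesis
    by (rule seq_open_subset_iff_le[OF p q])
next
  case False
  have "\<not> seq_open G R p \<subseteq> seq_open G R q"
  proof
    assume sub: "seq_open G R p \<subseteq> seq_open G R q"
    have "card (R (fst p) (fst q) `` {snd p}) \<ge> 2"
      using anti False p by (auto simp: seq_has_def anti_injective_def ind_poset_def)
    \<comment> \<open>Of the at least two elements below \<open>p\<close> on the level of
      \<open>q\<close>, one differs from \<open>q\<close>. Its basic set would lie in that of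
      \<open>q\<close>, which is impossible on one level.\<close>
    then have "\<not> R (fst p) (fst q) `` {snd p} \<subseteq> {snd q}"
      using card_mono[of "{snd q}" "R (fst p) (fst q) `` {snd p}"] by auto
    then obtain h where "h \<in> R (fst p) (fst q) `` {snd p}" "h \<notin> {snd q}"
      by (meson subsetI)
    then have h: "(snd p, h) \<in> R (fst p) (fst q)" "h \<noteq> snd q"
      by simp_all
    define r where "r = (fst q, h)"
    have "r \<in> P" "le r p"
      using h(1) R_subset[of "fst p" "fst q"] False by (auto simp: r_def ind_poset_def ind_le_def)
    then have "r = q"
      using seq_open_subset_same_level[of r q] seq_open_mono[of r p] sub p q by (auto simp: r_def)
    then show False
      using h(2) unfolding r_def by (metis snd_conv)
  qed
  then show ?thesis
    using False le_levelD by blast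
qed

lemma poset_iso_seq_open:
  assumes "seq_has anti_injective G R"
  shows "poset_iso P le (seq_open G R ` P) (\<subseteq>) (seq_open G R)"
  unfolding poset_iso_def
proof (intro conjI ballI)
  show "bij_betw (seq_open G R) P (seq_open G R ` P)"
  proof (rule inj_on_imp_bij_betw, rule inj_onI)
    fix p q assume "p \<in> P" "q \<in> P" "seq_open G R p = seq_open G R q"
    then have "le p q" "le q p"
      using seq_open_subset_iff_le_anti_injective[OF assms] by blast+
    then show "p = q"
      using le_levelD le_same_level by (meson order_antisym)
  qed
qed (use seq_open_subset_iff_le_anti_injective[OF assms] in blast)

end

theorem proposition4p19:
  fixes G :: "nat \<Rightarrow> 'a fgraph" and R :: "nat \<Rightarrow> nat \<Rightarrow> ('a \<times> 'a) set"
  assumes "graph_seq S_morphism G R" and "seq_has surjective G R"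
  shows "(\<forall>n. open_cover (seq_spectrum G R) (level_cover G R n)) \<and>
    (\<forall>C. open_cover (seq_spectrum G R) C \<longrightarrow> (\<exists>n. cover_refines (level_cover G R n) C)) \<and>
    (\<forall>n. consolidates (level_cover G R n) (level_cover G R (Suc n))) \<and>
    (graph_seq B_morphism G R \<longrightarrow>
      (\<forall>n. minimal_cover (seq_spectrum G R) (level_cover G R n) \<and>
           bij_betw (\<lambda>g. seq_open G R (n, g)) (verts (G n)) (level_cover G R n)) \<and>
      (\<forall>m n. m < n \<longrightarrow> (\<forall>g\<in>verts (G m). \<forall>h\<in>verts (G n).
         (g, h) \<in> R m n \<longleftrightarrow> seq_open G R (m, g) \<supseteq> seq_open G R (n, h))) \<and>
      (edge_faithful G R \<longrightarrow>
        (\<forall>n. graph_iso (G n) (overlap_graph (level_cover G R n)) (\<lambda>g. seq_open G R (n, g)))) \<and>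
      (seq_has anti_injective G R \<longrightarrow>
        poset_iso (ind_poset G) (ind_le R) (seq_open G R ` ind_poset G) (\<subseteq>) (seq_open G R)))"
proof (intro conjI allI impI)
  interpret surjective_seq G R
    using assms by unfold_locales
  show "open_cover (seq_spectrum G R) (level_cover G R n)" for n
    by (rule open_cover_level_cover)
  show "\<exists>n. cover_refines (level_cover G R n) C" if "open_cover (seq_spectrum G R) C" for C
    using that by (rule open_cover_refined_by_level_cover)
  show "consolidates (level_cover G R n) (level_cover G R (Suc n))" for n
    by (simp add: consolidates_level_cover)
  assume B: "graph_seq B_morphism G R"
  interpret co_bijective_seq G R
    using B by unfold_locales
  show "minimal_cover (seq_spectrum G R) (level_cover G R n)" for n
    by (rule minimal_cover_level_cover)
  show "bij_betw (\<lambda>g. seq_open G R (n, g)) (verts (G n)) (level_cover G R n)" for n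
    by (rule bij_betw_seq_open)
  show "\<forall>g\<in>verts (G m). \<forall>h\<in>verts (G n).
      (g, h) \<in> R m n \<longleftrightarrow> seq_open G R (m, g) \<supseteq> seq_open G R (n, h)" if "m < n" for m n
    using that by (auto simp: seq_open_subset_iff_le ind_poset_def ind_le_def)
  show "graph_iso (G n) (overlap_graph (level_cover G R n)) (\<lambda>g. seq_open G R (n, g))"
    if "edge_faithful G R" for n
    using that by (rule graph_iso_overlap_graph)
  show "poset_iso (ind_poset G) (ind_le R) (seq_open G R ` ind_poset G) (\<subseteq>) (seq_open G R)"
    if "seq_has anti_injective G R"
    using that by (rule poset_iso_seq_open)
qed

end
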